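(* Let $(X,\mathcal{F},\mu)$ be a measure space, and let $f : X \to [0,\infty]$ be a measurable function. Let $(f_n)_{n\in\mathbb{N}}$ be a sequence of measurable functions from $X$ to $[0,\infty]$ which converge to $f$ from below on $X$. Then $$\int_X f\,\mathrm{d}\mu = \lim_{n\to\infty} \int_X f_n\,\mathrm{d}\mu.$$
   Context: Let $X$ be a set, let $(f_n)$ be a sequence of functions from $X$ to $[0,\infty]$ and let $f$ be another function from $X$ to $[0,\infty]$. The functions $f_n$ are said to converge to $f$ from below on $X$ if $f_n$ tends to $f$ pointwise on $X$ and $f_n(x) \leq f(x)$ for all $n \in \mathbb{N}$ and all $x \in X$ (no monotonicity in $n$ is required). Integrals of measurable functions with values in $[0,\infty]$ take values in $[0,\infty]$, and limits are taken in $[0,\infty]$ (the value $\infty$ is allowed). *)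

theory Defs
  imports "HOL-Analysis.Analysis"
begin

definition converges_from_below_on ::
    "'a set \<Rightarrow> (nat \<Rightarrow> 'a \<Rightarrow> ennreal) \<Rightarrow> ('a \<Rightarrow> ennreal) \<Rightarrow> bool" where
  "converges_from_below_on X F f \<longleftrightarrow>
     (\<forall>x\<in>X. (\<lambda>n. F n x) \<longlonglongrightarrow> f x) \<and> (\<forall>n. \<forall>x\<in>X. F n x \<le> f x)"

end

theory Submission
  imports Defs
begin

text \<open>
  The pointwise bounds \<open>F n \<le> f\<close> make the integral of \<open>f\<close> an upper bound for every integral of
  \<open>F n\<close>, hence for their limit superior.  As \<open>f\<close> is the pointwise limit, and so the pointwise limit
  inferior, of the \<open>F n\<close>, Fatou's lemma makes the same number a lower bound for the limit inferior
  of the integrals.  The limit inferior and the limit superior therefore both equal the integral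
  of \<open>f\<close>.
\<close>

theorem theorem1p2:
  fixes M :: "'a measure"
    and f :: "'a \<Rightarrow> ennreal"
    and F :: "nat \<Rightarrow> 'a \<Rightarrow> ennreal"
  assumes "f \<in> borel_measurable M"
    and "\<And>n. F n \<in> borel_measurable M"
    and "converges_from_below_on (space M) F f"
  shows "(\<lambda>n. \<integral>\<^sup>+ x. F n x \<partial>M) \<longlonglongrightarrow> (\<integral>\<^sup>+ x. f x \<partial>M)"
proof -
  let ?I = "\<lambda>n. \<integral>\<^sup>+ x. F n x \<partial>M"
  have lim: "(\<lambda>n. F n x) \<longlonglongrightarrow> f x" and below: "F n x \<le> f x" if "x \<in> space M" for x n
    using assms(3) that by (auto simp: converges_from_below_on_def)
  have upper: "limsup ?I \<le> (\<integral>\<^sup>+ x. f x \<partial>M)"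
    by (intro Limsup_bounded always_eventually allI nn_integral_mono below)
  have "(\<integral>\<^sup>+ x. f x \<partial>M) = (\<integral>\<^sup>+ x. liminf (\<lambda>n. F n x) \<partial>M)"
    by (intro nn_integral_cong lim_imp_Liminf[symmetric] lim) simp_all
  also have "\<dots> \<le> liminf ?I"
    by (rule nn_integral_liminf) (rule assms(2))
  finally have lower: "(\<integral>\<^sup>+ x. f x \<partial>M) \<le> liminf ?I" .
  have "liminf ?I \<le> limsup ?I"
    by (rule Liminf_le_Limsup) simp
  with upper lower show ?thesis
    by (intro Liminf_eq_Limsup) auto
qed

end
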